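(* Let $P$ be a partition of $\mathcal{R}$, let $f$ be a $P$-admissible reward object, and let $T$ be the set of all reward transformations that preserve $P$. Then $f$ is $P$-robust to misspecification with $g$ if and only if $g=f\circ t$ for some $t\in T$ where $f\circ t\neq f$.
   Context: $\mathcal{S}$ and $\mathcal{A}$ are finite sets; $\mathcal{R}$ is the set of all functions $R:\mathcal{S}\times\mathcal{A}\times\mathcal{S}\to\mathbb{R}$. A reward object is a function $f:\mathcal{R}\to X$ for some set $X$; $g$ is a reward object. For a partition $P$ of $\mathcal{R}$, write $R_1\equiv_P R_2$ if $R_1,R_2$ lie in the same class. $f$ is $P$-admissible if $f(R_1)=f(R_2)\Rightarrow R_1\equiv_P R_2$. $f$ is $P$-robust to misspecification with $g$ if $f$ is $P$-admissible, $f\neq g$, $\mathrm{Im}(g)\subseteq\mathrm{Im}(f)$, and $f(R_1)=g(R_2)\Rightarrow R_1\equiv_P R_2$ for all $R_1,R_2\in\mathcal{R}$. A reward transformation is a function $t:\mathcal{R}\to\mathcal{R}$; it preserves $P$ if $t(R)\equiv_P R$ for all $R\in\mathcal{R}$. *)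

theory Defs
  imports Complex_Main "HOL-Library.FuncSet" "HOL-Library.Disjoint_Sets"
begin

text \<open>
  Functions with a domain that is a proper subset of a type are represented extensionally, that is,
  with value \<^term>\<open>undefined\<close> off the domain. Equality in HOL then is equality of functions on
  the domain, and composition is \<^const>\<open>compose\<close>. Functions are identified with their graphs:
  enlarging the codomain does not change a function.
\<close>

definition rewards :: "'s set \<Rightarrow> 'a set \<Rightarrow> ('s \<times> 'a \<times> 's \<Rightarrow> real) set" where
  "rewards S A = S \<times> A \<times> S \<rightarrow>\<^sub>E (UNIV :: real set)"

definition reward_object ::
    "'s set \<Rightarrow> 'a set \<Rightarrow> (('s \<times> 'a \<times> 's \<Rightarrow> real) \<Rightarrow> 'x) \<Rightarrow> bool" where
  "reward_object S A f \<longleftrightarrow> (\<exists>X. f \<in> rewards S A \<rightarrow>\<^sub>E X)"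

definition same_class :: "'r set set \<Rightarrow> 'r \<Rightarrow> 'r \<Rightarrow> bool" where
  "same_class P R1 R2 \<longleftrightarrow> (\<exists>C\<in>P. R1 \<in> C \<and> R2 \<in> C)"

definition admissible ::
    "'s set \<Rightarrow> 'a set \<Rightarrow> ('s \<times> 'a \<times> 's \<Rightarrow> real) set set \<Rightarrow>
      (('s \<times> 'a \<times> 's \<Rightarrow> real) \<Rightarrow> 'x) \<Rightarrow> bool" where
  "admissible S A P f \<longleftrightarrow>
     (\<forall>R1\<in>rewards S A. \<forall>R2\<in>rewards S A. f R1 = f R2 \<longrightarrow> same_class P R1 R2)"

definition robust_to_misspecification_with ::
    "'s set \<Rightarrow> 'a set \<Rightarrow> ('s \<times> 'a \<times> 's \<Rightarrow> real) set set \<Rightarrow>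
      (('s \<times> 'a \<times> 's \<Rightarrow> real) \<Rightarrow> 'x) \<Rightarrow> (('s \<times> 'a \<times> 's \<Rightarrow> real) \<Rightarrow> 'x) \<Rightarrow> bool" where
  "robust_to_misspecification_with S A P f g \<longleftrightarrow>
     admissible S A P f \<and>
     f \<noteq> g \<and>
     g ` rewards S A \<subseteq> f ` rewards S A \<and>
     (\<forall>R1\<in>rewards S A. \<forall>R2\<in>rewards S A. f R1 = g R2 \<longrightarrow> same_class P R1 R2)"

definition reward_transformation ::
    "'s set \<Rightarrow> 'a set \<Rightarrow>
      (('s \<times> 'a \<times> 's \<Rightarrow> real) \<Rightarrow> ('s \<times> 'a \<times> 's \<Rightarrow> real)) \<Rightarrow> bool" where
  "reward_transformation S A t \<longleftrightarrow> t \<in> rewards S A \<rightarrow>\<^sub>E rewards S A"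

definition preserves ::
    "'s set \<Rightarrow> 'a set \<Rightarrow> ('s \<times> 'a \<times> 's \<Rightarrow> real) set set \<Rightarrow>
      (('s \<times> 'a \<times> 's \<Rightarrow> real) \<Rightarrow> ('s \<times> 'a \<times> 's \<Rightarrow> real)) \<Rightarrow> bool" where
  "preserves S A P t \<longleftrightarrow> (\<forall>R\<in>rewards S A. same_class P (t R) R)"

end

theory Submission
  imports Defs
begin

text \<open>If the image of \<open>g\<close> lies in that of \<open>f\<close>, then choosing for
  each reward an \<open>f\<close>-preimage of its \<open>g\<close>-value gives a map
  \<open>t\<close> with \<open>g\<close> equal to \<open>f\<close> after \<open>t\<close>. Since
  \<open>f (t R) = g R\<close>, robustness itself says that \<open>t R\<close> and \<open>R\<close>
  share a class. Conversely, if \<open>g\<close> is \<open>f\<close> after \<open>t\<close>, then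
  \<open>f R1 = g R2\<close> means \<open>f R1 = f (t R2)\<close>; admissibility links
  \<open>R1\<close> to \<open>t R2\<close>, preservation links \<open>t R2\<close> to
  \<open>R2\<close>, and transitivity joins the two.\<close>

text \<open>The two classes both contain \<open>y\<close>, so disjointness makes them equal.\<close>

lemma same_class_trans:
  assumes "partition_on X P" "same_class P x y" "same_class P y z"
  shows "same_class P x z"
proof -
  obtain C where C: "C \<in> P" "x \<in> C" "y \<in> C"
    using assms(2) unfolding same_class_def by blast
  obtain D where D: "D \<in> P" "y \<in> D" "z \<in> D"
    using assms(3) unfolding same_class_def by blast
  have "C = D"
    using partition_onD2[OF assms(1)] C D unfolding disjoint_def by blast
  with C D show ?thesis
    unfolding same_class_def by blast
qed

theorem lemma2p2:
  fixes S :: "'s set" and A :: "'a set"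
    and P :: "('s \<times> 'a \<times> 's \<Rightarrow> real) set set"
    and f g :: "('s \<times> 'a \<times> 's \<Rightarrow> real) \<Rightarrow> 'x"
    and T :: "(('s \<times> 'a \<times> 's \<Rightarrow> real) \<Rightarrow> ('s \<times> 'a \<times> 's \<Rightarrow> real)) set"
  assumes "finite S" and "finite A"
    and "partition_on (rewards S A) P"
    and "reward_object S A f" and "admissible S A P f"
    and "reward_object S A g"
    and "T = {t. reward_transformation S A t \<and> preserves S A P t}"
  shows "robust_to_misspecification_with S A P f g \<longleftrightarrow>
    (\<exists>t\<in>T. g = compose (rewards S A) f t \<and> compose (rewards S A) f t \<noteq> f)"
proof
  let ?R = "rewards S A"
  assume rob: "robust_to_misspecification_with S A P f g"
  have img: "g ` ?R \<subseteq> f ` ?R" and ne: "f \<noteq> g"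
    and same: "\<And>R1 R2. \<lbrakk>R1 \<in> ?R; R2 \<in> ?R; f R1 = g R2\<rbrakk> \<Longrightarrow> same_class P R1 R2"
    using rob unfolding robust_to_misspecification_with_def by auto
  \<comment> \<open>A choice of preimages under \<open>f\<close>; restricting makes \<open>t\<close>
    extensional, as a reward transformation must be.\<close>
  define t where "t = restrict (\<lambda>r. inv_into ?R f (g r)) ?R"
  have t: "t r \<in> ?R" "f (t r) = g r" if "r \<in> ?R" for r
  proof -
    have "g r \<in> f ` ?R"
      using img that by blast
    then show "t r \<in> ?R" "f (t r) = g r"
      using that by (simp_all add: t_def inv_into_into f_inv_into_f)
  qed
  have "reward_transformation S A t"
    unfolding reward_transformation_def using t(1) by (auto simp: t_def)
  \<comment> \<open>Robustness is applied to the pair \<open>t R\<close>, \<open>R\<close>.\<close>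
  moreover have "preserves S A P t"
    unfolding preserves_def using same t by blast
  moreover have "g = compose ?R f t"
  proof
    fix r
    show "g r = compose ?R f t r"
      \<comment> \<open>Off the domain both sides are \<open>undefined\<close>, on the left because
        \<open>g\<close> is extensional.\<close>
      using t(2)[of r] \<open>reward_object S A g\<close>
      by (cases "r \<in> ?R") (auto simp: compose_def reward_object_def)
  qed
  ultimately show "\<exists>t\<in>T. g = compose ?R f t \<and> compose ?R f t \<noteq> f"
    using ne assms(7) by auto
next
  let ?R = "rewards S A"
  assume "\<exists>t\<in>T. g = compose ?R f t \<and> compose ?R f t \<noteq> f"
  then obtain t where t: "t \<in> ?R \<rightarrow>\<^sub>E ?R" "preserves S A P t"
    and g: "g = compose ?R f t" "f \<noteq> g"
    using assms(7) unfolding reward_transformation_def by auto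
  have g_eq: "t r \<in> ?R" "g r = f (t r)" if "r \<in> ?R" for r
    using t(1) that by (auto simp: g(1) compose_def)
  have "same_class P R1 R2" if R: "R1 \<in> ?R" "R2 \<in> ?R" "f R1 = g R2" for R1 R2
  proof (rule same_class_trans[OF assms(3)])
    \<comment> \<open>Here \<open>f R1 = g R2 = f (t R2)\<close>, so admissibility of
      \<open>f\<close> applies.\<close>
    show "same_class P R1 (t R2)"
      using assms(5) R g_eq unfolding admissible_def by auto
    show "same_class P (t R2) R2"
      using t(2) R(2) unfolding preserves_def by blast
  qed
  then show "robust_to_misspecification_with S A P f g"
    unfolding robust_to_misspecification_with_def
    using assms(5) g(2) g_eq by auto
qed

end
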